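(* Let $p>2$ be a prime, and let $\ell=1+n\,p$, $n\ge 2$, be a prime number which does not divide the integer $\theta_n=\prod_{i,j=1}^{n}(\xi_i+\xi_j+1)$, where $\xi_1,\ldots,\xi_n$ are the $n$-th roots of unity. Suppose moreover that $p$ is not a $p$-th power modulo $\ell$. Then the first case of Fermat's last theorem holds for $p$, i.e. there are no integers $a,b,c$ with $p\nmid abc$ and $a^p+b^p+c^p=0$.
   Context: The $n$-th roots of unity are taken in $\mathbb{C}$ (or in $\overline{\mathbb{Q}}$); $\theta_n$ is a rational integer. *)

theory Defs
  imports
    "HOL-Number_Theory.Cong"
    "HOL-Computational_Algebra.Fundamental_Theorem_Algebra"
    "Jordan_Normal_Form.Determinant"
begin

(* The product is taken over the complex numbers; theta n is the rational integer it equals.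
   Lemma of_int_theta below shows that this integer exists for every n > 0. *)
definition theta :: "nat \<Rightarrow> int" where
  "theta n = (THE m. of_int m =
     (\<Prod>x | x ^ n = (1::complex). \<Prod>y | y ^ n = (1::complex). x + y + 1))"

lemma prod_roots_unity_minus:
  fixes z :: complex
  assumes "n > 0"
  shows "(\<Prod>y | y ^ n = 1. z - y) = z ^ n - 1"
proof -
  define p :: "complex poly" where "p = Polynomial.monom 1 n - 1"
  have poly: "poly p x = x ^ n - 1" for x
    by (simp add: p_def poly_monom)
  have "rsquarefree p"
    unfolding rsquarefree_roots
    using assms by (auto simp: p_def poly_monom pderiv_monom pderiv_diff power_0_left)
  have deg: "degree p = n"
    unfolding p_def diff_conv_add_uminus using assms
    by (subst degree_add_eq_left) (auto simp: Polynomial.degree_monom_eq)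
  have lc: "lead_coeff p = 1"
    unfolding deg using assms by (simp add: p_def)
  have roots: "{y. poly p y = 0} = {y. y ^ n = 1}"
    by (simp add: poly)
  have "Polynomial.smult (lead_coeff p) (\<Prod>y | poly p y = 0. [:-y, 1:]) = p"
    using \<open>rsquarefree p\<close> by (rule complex_poly_decompose_rsquarefree)
  hence "p = (\<Prod>y | y ^ n = 1. [:-y, 1:])"
    unfolding roots lc by simp
  hence "poly p z = poly (\<Prod>y | y ^ n = 1. [:-y, 1:]) z"
    by (rule arg_cong)
  thus ?thesis
    by (simp add: poly poly_prod)
qed

(* A product of values of an integer polynomial over the n-th roots of unity is the determinant
   of an integer circulant matrix. *)
lemma prod_roots_unity_int:
  fixes c :: "nat \<Rightarrow> int"
  assumes n: "n > 0"
  shows "(\<Prod>x | x ^ n = (1::complex). \<Sum>j<n. of_int (c j) * x ^ j) \<in> \<int>"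
proof -
  obtain w where w: "bij_betw w {..<n} {x::complex. x ^ n = 1}"
    using bij_betw_roots_unity[OF n] by blast
  have w1: "w k ^ n = 1" if "k < n" for k
    using bij_betwE[OF w] that by auto
  have w0: "w k \<noteq> 0" if "k < n" for k
    using w1[OF that] n by (auto simp: power_0_left)
  define Q where "Q = (\<lambda>x::complex. \<Sum>j<n. of_int (c j) * x ^ j)"
  define A0 :: "int mat" where "A0 = mat n n (\<lambda>(i,j). c ((i + (n - j)) mod n))"
  define A :: "complex mat" where "A = map_mat of_int A0"
  define V where "V = mat n n (\<lambda>(k,i). w k ^ i)"
  define U where "U = mat n n (\<lambda>(i,l). inverse (w l) ^ i / of_nat n)"
  define D where "D = mat n n (\<lambda>(k,l). if k = l then Q (w k) else 0)"
  have A: "A \<in> carrier_mat n n" and V: "V \<in> carrier_mat n n"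
    and U: "U \<in> carrier_mat n n" and D: "D \<in> carrier_mat n n"
    by (auto simp: A_def A0_def V_def U_def D_def)
  have pmod: "w k ^ (m mod n) = w k ^ m" if "k < n" for k m
  proof -
    have "w k ^ m = w k ^ (n * (m div n) + m mod n)" by simp
    also have "\<dots> = w k ^ (m mod n)"
      unfolding power_add power_mult using w1[OF that] by simp
    finally show ?thesis by simp
  qed
  have VA: "V * A = D * V"
  proof (rule eq_matI)
    fix k j assume "k < dim_row (D * V)" "j < dim_col (D * V)"
    hence k: "k < n" and j: "j < n" by (auto simp: D_def V_def)
    have bij: "bij_betw (\<lambda>m. (m + j) mod n) {..<n} {..<n}"
    proof (rule bij_betw_byWitness[where f' = "\<lambda>i. (i + (n - j)) mod n"])
      have "((m + j) mod n + (n - j)) mod n = m" if "m < n" for m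
      proof -
        have "((m + j) mod n + (n - j)) mod n = (m + j + (n - j)) mod n"
          by (simp add: mod_add_left_eq)
        thus ?thesis using that j by simp
      qed
      thus "\<forall>m\<in>{..<n}. ((m + j) mod n + (n - j)) mod n = m" by simp
      have "((i + (n - j)) mod n + j) mod n = i" if "i < n" for i
      proof -
        have "((i + (n - j)) mod n + j) mod n = (i + (n - j) + j) mod n"
          by (simp add: mod_add_left_eq)
        thus ?thesis using that j by simp
      qed
      thus "\<forall>i\<in>{..<n}. ((i + (n - j)) mod n + j) mod n = i" by simp
    qed (use n in auto)
    have inv: "((m + j) mod n + (n - j)) mod n = m" if "m < n" for m
    proof -
      have "((m + j) mod n + (n - j)) mod n = (m + j + (n - j)) mod n"
        by (simp add: mod_add_left_eq)
      thus ?thesis using that j by simp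
    qed
    have "(V * A) $$ (k, j) = (\<Sum>i<n. w k ^ i * of_int (c ((i + (n - j)) mod n)))"
      using k j by (simp add: V_def A_def A0_def scalar_prod_def atLeast0LessThan)
    also have "\<dots> = (\<Sum>m<n. w k ^ ((m + j) mod n) *
        of_int (c (((m + j) mod n + (n - j)) mod n)))"
      by (rule sum.reindex_bij_betw[OF bij, symmetric])
    also have "\<dots> = (\<Sum>m<n. of_int (c m) * w k ^ m * w k ^ j)"
      by (intro sum.cong refl, subst inv) (auto simp: pmod[OF k] power_add)
    also have "\<dots> = Q (w k) * w k ^ j"
      by (simp add: Q_def sum_distrib_right)
    also have "\<dots> = (\<Sum>l<n. if l = k then Q (w k) * w k ^ j else 0)"
      using k by simp
    also have "\<dots> = (\<Sum>l<n. (if k = l then Q (w k) else 0) * w l ^ j)"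
      by (rule sum.cong) auto
    also have "\<dots> = (D * V) $$ (k, j)"
      using k j by (simp add: D_def V_def scalar_prod_def atLeast0LessThan)
    finally show "(V * A) $$ (k, j) = (D * V) $$ (k, j)" .
  qed (use A V D in auto)
  have VU: "V * U = 1\<^sub>m n"
  proof (rule eq_matI)
    fix k l assume "k < dim_row (1\<^sub>m n :: complex mat)" "l < dim_col (1\<^sub>m n :: complex mat)"
    hence k: "k < n" and l: "l < n" by auto
    define q where "q = w k / w l"
    have "(V * U) $$ (k, l) = (\<Sum>i<n. q ^ i) / of_nat n"
      using k l by (simp add: V_def U_def scalar_prod_def atLeast0LessThan q_def
          sum_divide_distrib power_divide field_simps)
    also have "\<dots> = (if k = l then 1 else 0)"
    proof (cases "k = l")
      case True
      thus ?thesis using w0[OF k] n by (simp add: q_def)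
    next
      case False
      hence "w k \<noteq> w l"
        using bij_betw_imp_inj_on[OF w] k l by (auto simp: inj_on_def)
      hence "q \<noteq> 1" using w0[OF l] by (simp add: q_def)
      moreover have "q ^ n = 1" using w1[OF k] w1[OF l] by (simp add: q_def power_divide)
      ultimately show ?thesis using False by (simp add: geometric_sum)
    qed
    finally show "(V * U) $$ (k, l) = 1\<^sub>m n $$ (k, l)" using k l by simp
  qed (use V U in auto)
  have "det V * det U = 1"
    using det_mult[OF V U] by (simp add: VU)
  hence "det V \<noteq> 0" by auto
  moreover have "det V * det A = det D * det V"
    using det_mult[OF V A] det_mult[OF D V] unfolding VA by argo
  ultimately have "det A = det D" by (metis mult.commute mult_left_cancel)
  also have "det D = (\<Prod>k<n. Q (w k))"
    by (subst det_upper_triangular[OF _ D])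
       (auto simp: D_def prod_list_diag_prod atLeast0LessThan)
  also have "\<dots> = (\<Prod>x | x ^ n = 1. Q x)"
    by (rule prod.reindex_bij_betw[OF w])
  finally have "(\<Prod>x | x ^ n = 1. Q x) = of_int (det A0)"
    by (simp add: A_def of_int_hom.hom_det)
  thus ?thesis by (simp add: Q_def)
qed

lemma of_int_theta:
  assumes n: "n > 0"
  shows "of_int (theta n) =
    (\<Prod>x | x ^ n = (1::complex). \<Prod>y | y ^ n = (1::complex). x + y + 1)"
proof -
  let ?P = "\<Prod>x | x ^ n = (1::complex). \<Prod>y | y ^ n = (1::complex). x + y + 1"
  define c :: "nat \<Rightarrow> int"
    where "c = (\<lambda>j. if j = 0 then 2 - (-1) ^ n else of_nat (n choose j))"
  have "(\<Prod>y | y ^ n = 1. x + y + 1) = (\<Sum>j<n. of_int (c j) * x ^ j)"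
    if x: "x ^ n = 1" for x :: complex
  proof -
    have "(\<Prod>y | y ^ n = 1. x + y + 1) = (\<Prod>y | y ^ n = (1::complex). -1 * (- (x + 1) - y))"
      by (rule prod.cong) auto
    also have "\<dots> = (-1) ^ n * ((- (x + 1)) ^ n - 1)"
      by (simp only: prod.distrib prod_roots_unity_minus[OF n] prod_constant
            card_roots_unity_eq[OF n])
    also have "(- (x + 1)) ^ n = (-1) ^ n * (x + 1) ^ n"
      by (rule power_minus)
    also have "(-1) ^ n * ((-1) ^ n * (x + 1) ^ n - 1) = (x + 1) ^ n - (-1) ^ n"
      by (simp add: algebra_simps flip: power_mult_distrib mult.assoc)
    also have "(x + 1) ^ n = (\<Sum>j\<le>n. of_nat (n choose j) * x ^ j)"
      by (simp add: binomial_ring)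
    also have "\<dots> = (\<Sum>j<n. of_nat (n choose j) * x ^ j) + 1"
      by (simp add: lessThan_Suc_atMost[symmetric] x)
    also have "(\<Sum>j<n. of_nat (n choose j) * x ^ j) + 1 - (-1) ^ n =
        (\<Sum>j<n. of_int (c j) * x ^ j)"
    proof -
      obtain m where m: "n = Suc m" using n gr0_implies_Suc by blast
      show ?thesis
        unfolding m sum.lessThan_Suc_shift by (simp add: c_def m)
    qed
    finally show ?thesis .
  qed
  hence "?P = (\<Prod>x | x ^ n = (1::complex). \<Sum>j<n. of_int (c j) * x ^ j)"
    by (intro prod.cong) auto
  hence "?P \<in> \<int>"
    using prod_roots_unity_int[OF n] by simp
  then obtain m :: int where m: "?P = of_int m"
    by (elim Ints_cases)
  show ?thesis
    unfolding theta_def by (rule theI[of _ m]) (auto simp: m)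
qed

end

theory Submission
  imports Defs "HOL-Number_Theory.Residues" "HOL-Computational_Algebra.Nth_Powers"
begin

text \<open>
  Suppose \<open>a\<^sup>p + b\<^sup>p + c\<^sup>p = 0\<close> with \<open>a\<close>, \<open>b\<close>, \<open>c\<close> pairwise coprime and none of them divisible
  by \<open>p\<close>. This is a case of Sophie Germain's theorem: the prime \<open>l = 1 + n p\<close> contradicts such a
  solution as soon as two nonzero \<open>p\<close>-th powers modulo \<open>l\<close> never differ by \<open>1\<close> and \<open>p\<close> itself is not
  a \<open>p\<close>-th power modulo \<open>l\<close>.

  The condition on \<open>theta n\<close> gives the first of these two properties. The nonzero \<open>p\<close>-th powers
  modulo \<open>l\<close> are \<open>n\<close>-th roots of unity, because \<open>l - 1 = n p\<close>, so a relation \<open>a + b + 1 = 0\<close> among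
  them makes one factor of the product for \<open>theta n\<close>, read modulo \<open>l\<close>, vanish. The product is formed
  over the complex numbers, however, and has to be carried over to the integers modulo \<open>l\<close>. Since
  \<open>n\<close> is even, \<open>theta n\<close> is the value at \<open>t = 0\<close> of
  \<open>F(t) = (\<Prod>x | x^n = 1. (x + 1)^n - 1 + t)\<close>.
  This polynomial takes integer values at integers, and its degree \<open>n\<close> is less than \<open>l\<close>. A
  finite-difference argument shows that the values of such a polynomial modulo \<open>l\<close> depend only on
  \<open>t\<close> modulo \<open>l\<close> (\<open>integer_valued_poly_cong\<close>). At \<open>t = 1 - (a + 1)^n\<close>, which is \<open>0\<close> modulo \<open>l\<close>,
  every factor of \<open>F(t)\<close> is divisible by \<open>x - a\<close>; hence \<open>F(t)\<close> is divisible by \<open>a^n - 1\<close>, and so by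
  \<open>l\<close> (\<open>prime_dvd_thetaI\<close>).

  For Germain's argument, one of \<open>a\<close>, \<open>b\<close>, \<open>c\<close> is divisible by \<open>l\<close>, say \<open>a\<close>. The sums \<open>b + c\<close>,
  \<open>c + a\<close>, \<open>a + b\<close> and their cofactors in the sums of \<open>p\<close>-th powers are \<open>p\<close>-th powers
  (\<open>barlow_relations\<close>). A second use of the property forces \<open>l\<close> to divide \<open>b + c\<close>, and then the two
  cofactors \<open>(b\<^sup>p + c\<^sup>p) / (b + c)\<close> and \<open>(a\<^sup>p + b\<^sup>p) / (a + b)\<close> have quotient \<open>p\<close> modulo \<open>l\<close>. So \<open>p\<close> is a
  \<open>p\<close>-th power modulo \<open>l\<close> (\<open>germain_no_divisible_solution\<close>), a contradiction.
\<close>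

section \<open>Integer-valued polynomials of degree less than a prime\<close>

text \<open>
  The sum is, up to sign, the \<open>m\<close>-th finite difference of \<open>P\<close> at \<open>0\<close>. For \<open>P = a + X Q\<close> the identity
  \<open>j * (m choose j) = m * (m - 1 choose (j - 1))\<close> absorbs the factor \<open>X\<close> and leaves the
  \<open>(m - 1)\<close>-st difference of \<open>Q(X + 1)\<close>, whose degree is one less.
\<close>

lemma alternating_binomial_sum_poly_eq_0:
  fixes P :: "'a::idom poly"
  assumes "degree P < m"
  shows "(\<Sum>j\<le>m. (-1) ^ j * of_nat (m choose j) * poly P (of_nat j)) = 0"
  using assms
proof (induction m arbitrary: P)
  case (Suc m)
  obtain a Q where P: "P = pCons a Q"
    by (cases P)
  define R where "R = Q \<circ>\<^sub>p [:1, 1:]"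
  have R: "(\<Sum>i\<le>m. (-1) ^ i * of_nat (m choose i) * poly R (of_nat i)) = 0"
  proof (cases "Q = 0")
    case False
    hence "degree R < m"
      using Suc.prems by (simp add: P R_def degree_pcompose)
    thus ?thesis by (rule Suc.IH)
  qed (simp add: R_def)
  have absorb: "(-1) ^ Suc i * of_nat (Suc m choose Suc i) *
        (of_nat (Suc i) * poly Q (of_nat (Suc i))) =
      - of_nat (Suc m) * ((-1) ^ i * of_nat (m choose i) * poly R (of_nat i))" for i
  proof -
    have "of_nat (Suc m choose Suc i) * of_nat (Suc i) = (of_nat (Suc m) * of_nat (m choose i) :: 'a)"
      using Suc_times_binomial[of i m] by (metis mult.commute of_nat_mult)
    moreover have "poly R (of_nat i) = poly Q (of_nat (Suc i))"
      by (simp add: R_def poly_pcompose)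
    ultimately show ?thesis
      by (simp add: algebra_simps del: of_nat_Suc binomial_Suc_Suc)
  qed
  have "(\<Sum>j\<le>Suc m. (-1) ^ j * of_nat (Suc m choose j) * poly P (of_nat j)) =
      a * (\<Sum>j\<le>Suc m. (-1) ^ j * of_nat (Suc m choose j)) +
      (\<Sum>j\<le>Suc m. (-1) ^ j * of_nat (Suc m choose j) * (of_nat j * poly Q (of_nat j)))"
    unfolding sum_distrib_left sum.distrib[symmetric]
    by (rule sum.cong) (simp_all add: P algebra_simps)
  also have "(\<Sum>j\<le>Suc m. (-1) ^ j * of_nat (Suc m choose j)) = (0 :: 'a)"
    by (rule choose_alternating_sum) simp
  also have "(\<Sum>j\<le>Suc m. (-1) ^ j * of_nat (Suc m choose j) * (of_nat j * poly Q (of_nat j))) =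
      (\<Sum>i\<le>m. - of_nat (Suc m) * ((-1) ^ i * of_nat (m choose i) * poly R (of_nat i)))"
    by (subst sum.atMost_Suc_shift) (simp only: absorb of_nat_0 mult_zero_left mult_zero_right add_0_left)
  also have "\<dots> = 0"
    unfolding sum_distrib_left[symmetric] R by simp
  finally show ?case by simp
qed simp

text \<open>
  \<open>P\<close> need not have integer coefficients, so the congruence is not formal; it fails for
  \<open>P = X (X - 1) \<dots> (X - l + 1) / l!\<close>, of degree \<open>l\<close>. Below that degree the \<open>l\<close>-th finite difference
  of \<open>P\<close> vanishes, and modulo \<open>l\<close> only its two outer terms remain, since \<open>l\<close> divides the other
  binomial coefficients.
\<close>

lemma integer_valued_poly_cong_shift:
  fixes P :: "'a::{idom,ring_char_0} poly" and f :: "int \<Rightarrow> int" and l :: nat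
  assumes l: "prime l" "odd l" and deg: "degree P < l"
    and f: "\<And>t. of_int (f t) = poly P (of_int t)"
  shows "[f (t + int l) = f t] (mod int l)"
proof -
  define Pt where "Pt = P \<circ>\<^sub>p [:of_int t, 1:]"
  define u where "u = (\<lambda>j. (-1) ^ j * int (l choose j) * f (t + int j))"
  have "degree Pt < l"
    using deg by (simp add: Pt_def degree_pcompose)
  hence "(\<Sum>j\<le>l. (-1) ^ j * of_nat (l choose j) * poly Pt (of_nat j)) = 0"
    by (rule alternating_binomial_sum_poly_eq_0)
  hence "of_int (\<Sum>j\<le>l. u j) = (0 :: 'a)"
    by (simp add: u_def Pt_def poly_pcompose f)
  hence "(\<Sum>j\<le>l. u j) = 0"
    unfolding of_int_eq_0_iff .
  moreover have "{..l} = insert 0 (insert l {0<..<l})"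
    using prime_gt_0_nat[OF l(1)] by auto
  ultimately have "f t - f (t + int l) = - sum u {0<..<l}"
    using l prime_gt_0_nat[OF l(1)] by (simp add: u_def)
  moreover have "int l dvd sum u {0<..<l}"
  proof (rule dvd_sum)
    fix j assume "j \<in> {0<..<l}"
    hence "int l dvd int (l choose j)"
      using l(1) by (subst int_dvd_int_iff) (rule dvd_choose_prime, auto)
    thus "int l dvd u j"
      by (simp add: u_def)
  qed
  ultimately have "int l dvd f t - f (t + int l)"
    by simp
  thus ?thesis
    by (simp add: cong_iff_dvd_diff dvd_diff_commute)
qed

lemma integer_valued_poly_cong:
  fixes P :: "'a::{idom,ring_char_0} poly" and f :: "int \<Rightarrow> int" and l :: nat
  assumes l: "prime l" "odd l" and deg: "degree P < l"
    and f: "\<And>t. of_int (f t) = poly P (of_int t)"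
    and st: "[s = t] (mod int l)"
  shows "[f s = f t] (mod int l)"
proof -
  have step: "[f (t + int l) = f t] (mod int l)" for t
    using l deg f by (rule integer_valued_poly_cong_shift)
  obtain k where k: "s = t + k * int l"
    using st by (metis cong_iff_lin mult.commute cong_sym)
  have "[f (t + k * int l) = f t] (mod int l)"
  proof (induction k rule: int_induct[of _ 0])
    case (step1 k)
    have "t + (k + 1) * int l = (t + k * int l) + int l"
      by (simp add: algebra_simps)
    thus ?case
      using step[of "t + k * int l"] step1 cong_trans by metis
  next
    case (step2 k)
    have "t + k * int l = (t + (k - 1) * int l) + int l"
      by (simp add: algebra_simps)
    thus ?case
      using step[of "t + (k - 1) * int l"] step2 cong_trans cong_sym by metis
  qed simp
  thus ?thesis by (simp add: k)
qed

section \<open>Prime divisors of theta\<close>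

text \<open>
  On the \<open>n\<close>-th roots of unity, exponents matter only modulo \<open>n\<close>, so \<open>q\<close> may be replaced by a
  polynomial of degree less than \<open>n\<close> before \<open>prod_roots_unity_int\<close> is applied.
\<close>

lemma prod_roots_unity_int_poly:
  fixes q :: "complex poly"
  assumes n: "n > 0" and q: "\<And>i. Polynomial.coeff q i \<in> \<int>"
  shows "(\<Prod>x | x ^ n = 1. poly q x) \<in> \<int>"
proof -
  have "\<exists>d. \<forall>i. Polynomial.coeff q i = of_int (d i)"
    by (rule choice) (use q in \<open>auto elim: Ints_cases\<close>)
  then obtain d where d: "\<And>i. Polynomial.coeff q i = of_int (d i)"
    by blast
  define c where "c = (\<lambda>j. \<Sum>i\<in>{i\<in>{..degree q}. i mod n = j}. d i)"
  have "poly q x = (\<Sum>j<n. of_int (c j) * x ^ j)" if x: "x ^ n = 1" for x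
  proof -
    have red: "x ^ i = x ^ (i mod n)" for i
      using power_add[of x "n * (i div n)" "i mod n"] by (simp add: power_mult x)
    have "poly q x = (\<Sum>i\<le>degree q. of_int (d i) * x ^ i)"
      by (simp add: poly_altdef d)
    also have "\<dots> = (\<Sum>j<n. \<Sum>i\<in>{i\<in>{..degree q}. i mod n = j}. of_int (d i) * x ^ i)"
      by (rule sum.group[symmetric]) (use n in auto)
    also have "\<dots> = (\<Sum>j<n. of_int (c j) * x ^ j)"
      unfolding c_def of_int_sum sum_distrib_right
      by (intro sum.cong refl) (use red in auto)
    finally show ?thesis .
  qed
  hence "(\<Prod>x | x ^ n = 1. poly q x) = (\<Prod>x | x ^ n = 1. \<Sum>j<n. of_int (c j) * x ^ j)"
    by (intro prod.cong) auto
  thus ?thesis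
    using prod_roots_unity_int[OF n] by simp
qed

lemma coeff_pcompose_X_plus_1_Ints:
  fixes q :: "complex poly"
  assumes "\<And>i. Polynomial.coeff q i \<in> \<int>"
  shows "Polynomial.coeff (q \<circ>\<^sub>p [:1, 1:]) i \<in> \<int>"
  by (rule coeff_pcompose_semiring_closed)
    (use assms in \<open>auto simp: coeff_pCons split: nat.splits\<close>)

text \<open>
  This transfers a zero factor modulo \<open>l\<close> to the complex product. The integer \<open>a\<close> is a root of
  \<open>(X + 1)^n - 1\<close> modulo \<open>l\<close> only; adding \<open>t = 1 - (a + 1)^n\<close> to the polynomial turns it into a true
  root, and changes the product over the roots of unity by a multiple of \<open>l\<close> only.
\<close>

lemma prime_dvd_thetaI:
  fixes a b :: int and l n :: nat
  assumes l: "prime l" and n: "n > 0" "even n" "n < l"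
    and a: "[a ^ n = 1] (mod int l)" and b: "[b ^ n = 1] (mod int l)"
    and ab: "[a + b + 1 = 0] (mod int l)"
  shows "int l dvd theta n"
proof -
  have "odd l"
    using prime_odd_nat[OF l] n by auto
  define P :: "complex poly" where "P = (\<Prod>x | x ^ n = 1. [:(x + 1) ^ n - 1, 1:])"
  have poly_P: "poly P t = (\<Prod>x | x ^ n = 1. (x + 1) ^ n - 1 + t)" for t
    by (simp add: P_def poly_prod algebra_simps)
  have "degree P \<le> (\<Sum>x::complex | x ^ n = 1. 1)"
    unfolding P_def
    by (rule order.trans[OF degree_prod_sum_le]) (use n in \<open>auto simp: finite_roots_unity\<close>)
  hence deg: "degree P < l"
    using n by (simp add: card_roots_unity_eq)
  have "poly P (of_int t) \<in> \<int>" for t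
  proof -
    define q :: "complex poly" where "q = Polynomial.monom 1 n + [:of_int t - 1:]"
    have "Polynomial.coeff q i \<in> \<int>" for i
      by (auto simp: q_def coeff_pCons split: nat.splits)
    hence "(\<Prod>x | x ^ n = 1. poly (q \<circ>\<^sub>p [:1, 1:]) x) \<in> \<int>"
      by (intro prod_roots_unity_int_poly n coeff_pcompose_X_plus_1_Ints)
    thus ?thesis
      by (simp add: poly_P q_def poly_pcompose poly_monom algebra_simps)
  qed
  hence "\<exists>m. of_int m = poly P (of_int t)" for t
    by (metis Ints_cases)
  hence "\<exists>f. \<forall>t. of_int (f t) = poly P (of_int t)"
    by (intro choice) blast
  then obtain f where f: "\<And>t. of_int (f t) = poly P (of_int t)"
    by blast
  have "of_int (theta n) = (of_int (f 0) :: complex)"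
  proof -
    have "(\<Prod>y | y ^ n = 1. x + y + 1) = (x + 1) ^ n - 1" for x :: complex
    proof -
      have "(\<Prod>y | y ^ n = 1. x + y + 1) = (\<Prod>y | y ^ n = (1::complex). -1 * (- (x + 1) - y))"
        by (rule prod.cong) auto
      also have "\<dots> = (- (x + 1)) ^ n - 1"
        using n by (simp only: prod.distrib prod_roots_unity_minus prod_constant
          card_roots_unity_eq) simp
      also have "(- (x + 1)) ^ n = (x + 1) ^ n"
        using n(2) by (rule power_minus_even)
      finally show ?thesis .
    qed
    thus ?thesis
      by (simp add: of_int_theta[OF n(1)] f poly_P)
  qed
  hence theta: "theta n = f 0"
    by simp
  define t where "t = 1 - (a + 1) ^ n"
  have "[t = 0] (mod int l)"
  proof -
    have "[a + 1 = - b] (mod int l)"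
      using ab by (simp add: cong_iff_dvd_diff algebra_simps)
    hence "[(a + 1) ^ n = (- b) ^ n] (mod int l)"
      by (rule cong_pow)
    also have "(- b) ^ n = b ^ n"
      using n by simp
    also note b
    finally show ?thesis
      by (simp add: t_def cong_iff_dvd_diff dvd_diff_commute)
  qed
  with l \<open>odd l\<close> deg f have "[f t = f 0] (mod int l)"
    by (rule integer_valued_poly_cong)
  moreover have "int l dvd f t"
  proof -
    define h :: "complex poly" where
      "h = (\<Sum>i<n. Polynomial.monom ((of_int a + 1) ^ (n - Suc i)) i) \<circ>\<^sub>p [:1, 1:]"
    have "Polynomial.coeff h i \<in> \<int>" for i
      unfolding h_def
      by (rule coeff_pcompose_X_plus_1_Ints) (auto simp: coeff_sum intro!: Ints_sum)
    hence "(\<Prod>x | x ^ n = 1. poly h x) \<in> \<int>"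
      by (rule prod_roots_unity_int_poly[OF n(1)])
    then obtain H where H: "(\<Prod>x | x ^ n = 1. poly h x) = of_int H"
      by (elim Ints_cases)
    \<comment> \<open>\<open>h\<close> is the quotient of \<open>(X + 1)^n - (a + 1)^n\<close> by \<open>X - a\<close>, written in powers of \<open>X + 1\<close>.\<close>
    have factor: "(x + 1) ^ n - 1 + of_int t = -1 * (of_int a - x) * poly h x" for x
      using power_diff_sumr2[of "x + 1" n "of_int a + 1"]
      by (simp add: t_def h_def poly_pcompose poly_sum poly_monom algebra_simps)
    have "of_int (f t) = (of_int ((a ^ n - 1) * H) :: complex)"
      unfolding f poly_P factor
      using n by (simp only: prod.distrib H prod_roots_unity_minus prod_constant
          card_roots_unity_eq) simp
    hence "f t = (a ^ n - 1) * H"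
      unfolding of_int_eq_iff .
    thus ?thesis
      using a by (simp add: cong_iff_dvd_diff)
  qed
  ultimately show ?thesis
    by (simp add: theta cong_dvd_iff)
qed

section \<open>Fermat equation modulo the auxiliary prime\<close>

lemma fermat_theorem_int:
  fixes x :: int and l :: nat
  assumes "prime l" "\<not> int l dvd x"
  shows "[x ^ (l - 1) = 1] (mod int l)"
proof -
  define m where "m = nat (x mod int l)"
  have l: "l > 0" using assms prime_gt_0_nat by blast
  hence m: "int m = x mod int l"
    by (simp add: m_def)
  hence "\<not> l dvd m"
    using assms by (metis dvd_mod_iff dvd_refl int_dvd_int_iff)
  hence "[m ^ (l - 1) = 1] (mod l)"
    using assms by (intro fermat_theorem)
  hence "[int m ^ (l - 1) = 1] (mod int l)"
    by (metis cong_int_iff of_nat_1 of_nat_power)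
  moreover have "[int m ^ (l - 1) = x ^ (l - 1)] (mod int l)"
    by (intro cong_pow) (simp add: m)
  ultimately show ?thesis
    using cong_trans cong_sym by blast
qed

lemma inverse_mod_prime:
  fixes x :: int and l :: nat
  assumes "prime l" "\<not> int l dvd x"
  obtains y where "[x * y = 1] (mod int l)"
proof -
  have "coprime x (int l)"
    using assms by (metis coprime_commute prime_imp_coprime prime_nat_int_transfer)
  thus thesis using cong_solve_coprime_int that by blast
qed

text \<open>
  Dividing by \<open>w\<^sup>p\<close> turns a solution without zeros into \<open>x\<^sup>p + y\<^sup>p + 1 = 0\<close>, where \<open>x\<^sup>p\<close> and \<open>y\<^sup>p\<close> are
  \<open>n\<close>-th roots of unity by Fermat's little theorem.
\<close>

lemma fermat_equation_mod_prime:
  fixes u v w :: int and l n p :: nat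
  assumes l: "prime l" "l = 1 + n * p" and p: "p > 1" and n: "n > 0" "even n"
    and theta: "\<not> int l dvd theta n"
    and eq: "[u ^ p + v ^ p + w ^ p = 0] (mod int l)"
  shows "int l dvd u \<or> int l dvd v \<or> int l dvd w"
proof (rule ccontr)
  assume *: "\<not> ?thesis"
  then obtain z where z: "[w * z = 1] (mod int l)"
    using inverse_mod_prime[OF l(1)] by metis
  have l_prime: "prime (int l)"
    using l(1) by simp
  have nz: "\<not> int l dvd z"
    using z l_prime by (metis cong_dvd_iff dvd_mult not_prime_unit)
  have unity: "[((x * z) ^ p) ^ n = 1] (mod int l)" if "\<not> int l dvd x" for x
  proof -
    have "\<not> int l dvd x * z"
      using that nz l_prime by (simp add: prime_dvd_mult_iff)
    from fermat_theorem_int[OF l(1) this] show ?thesis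
      using l(2) by (simp add: power_mult[symmetric] mult.commute)
  qed
  have "[(u ^ p + v ^ p + w ^ p) * z ^ p = 0 * z ^ p] (mod int l)"
    using eq by (rule cong_mult) simp
  hence "[(u * z) ^ p + (v * z) ^ p + (w * z) ^ p = 0] (mod int l)"
    by (simp add: power_mult_distrib distrib_right)
  moreover have "[(u * z) ^ p + (v * z) ^ p + (w * z) ^ p = (u * z) ^ p + (v * z) ^ p + 1] (mod int l)"
    using cong_pow[OF z, of p] by (intro cong_add cong_refl) simp
  ultimately have "[(u * z) ^ p + (v * z) ^ p + 1 = 0] (mod int l)"
    using cong_trans cong_sym by blast
  moreover have "n < l"
    using l(2) p n by (cases p) auto
  ultimately have "int l dvd theta n"
    using l(1) n * unity by (intro prime_dvd_thetaI[of l n "(u * z) ^ p" "(v * z) ^ p"]) auto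
  thus False using theta by simp
qed

section \<open>Sophie Germain's argument\<close>

text \<open>
  For odd \<open>p\<close> this is the quotient \<open>(x\<^sup>p + y\<^sup>p) / (x + y)\<close>; the sum also makes sense when \<open>x + y = 0\<close>.
\<close>

definition pow_sum_cofactor :: "nat \<Rightarrow> int \<Rightarrow> int \<Rightarrow> int" where
  "pow_sum_cofactor p x y = (\<Sum>i<p. (- y) ^ (p - Suc i) * x ^ i)"

lemma pow_sum_factor:
  assumes "odd p"
  shows "x ^ p + y ^ p = (x + y) * pow_sum_cofactor p x y"
  using power_diff_sumr2[of x p "- y"] assms by (simp add: pow_sum_cofactor_def)

lemma pow_sum_cofactor_cong_neg:
  assumes "odd p" "[x + y = 0] (mod m)"
  shows "[pow_sum_cofactor p x y = int p * y ^ (p - 1)] (mod m)"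
proof -
  have x: "[x = - y] (mod m)"
    using assms by (simp add: cong_iff_dvd_diff)
  have "[pow_sum_cofactor p x y = (\<Sum>i<p. (- y) ^ (p - Suc i) * (- y) ^ i)] (mod m)"
    unfolding pow_sum_cofactor_def by (intro cong_sum cong_mult cong_pow x cong_refl)
  also have "(\<Sum>i<p. (- y) ^ (p - Suc i) * (- y) ^ i) = (\<Sum>i<p. (- y) ^ (p - 1))"
    by (rule sum.cong) (auto simp flip: power_add)
  also have "\<dots> = int p * y ^ (p - 1)"
    using assms by simp
  finally show ?thesis .
qed

lemma pow_sum_cofactor_cong_0:
  assumes "odd p" "[x = 0] (mod m)"
  shows "[pow_sum_cofactor p x y = y ^ (p - 1)] (mod m)"
proof -
  obtain k where p: "p = Suc k"
    using assms by (metis odd_pos gr0_implies_Suc)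
  have "[pow_sum_cofactor p x y = (\<Sum>i<p. (- y) ^ (p - Suc i) * 0 ^ i)] (mod m)"
    unfolding pow_sum_cofactor_def by (intro cong_sum cong_mult cong_pow assms cong_refl)
  also have "(\<Sum>i<p. (- y) ^ (p - Suc i) * 0 ^ i) = y ^ (p - 1)"
    using assms(1) unfolding p sum.lessThan_Suc_shift by simp
  finally show ?thesis .
qed

lemma coprime_mult_eq_power_int:
  fixes x y z :: int
  assumes "odd p" and xy: "coprime x y" and eq: "x * y = z ^ p"
  obtains r where "x = r ^ p"
proof (cases "x = 0 \<or> y = 0")
  case True
  have "p > 0" using \<open>odd p\<close> by (rule odd_pos)
  show thesis
  proof (cases "x = 0")
    case True
    thus thesis using that[of 0] \<open>p > 0\<close> by simp
  next
    case False
    hence "\<bar>x\<bar> = 1" using True xy by simp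
    hence "x = 1 \<or> x = -1" by linarith
    thus thesis using that[of x] \<open>odd p\<close> by auto
  qed
next
  case False
  have "is_nth_power p (nat \<bar>x\<bar> * nat \<bar>y\<bar>)"
    by (rule is_nth_powerI[of _ "nat \<bar>z\<bar>"])
      (metis abs_mult eq nat_abs_mult_distrib nat_power_eq power_abs abs_ge_zero)
  moreover have "coprime (nat \<bar>x\<bar>) (nat \<bar>y\<bar>)"
    using xy by (simp add: coprime_nat_abs_left_iff coprime_nat_abs_right_iff)
  ultimately have "is_nth_power p (nat \<bar>x\<bar>)"
    using False by (intro is_nth_power_mult_coprime_natD(1)[of "nat \<bar>x\<bar>" "nat \<bar>y\<bar>"]) simp_all
  then obtain m where "nat \<bar>x\<bar> = m ^ p"
    by (elim is_nth_powerE)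
  hence "int (nat \<bar>x\<bar>) = int m ^ p"
    by simp
  hence "\<bar>x\<bar> = int m ^ p"
    by simp
  hence "x = (sgn x * int m) ^ p"
    using False \<open>odd p\<close> by (cases "x > 0") (auto simp: sgn_if)
  thus thesis by (rule that)
qed

text \<open>
  The two factors of \<open>b\<^sup>p + c\<^sup>p = (-a)\<^sup>p\<close> are coprime: modulo a common prime divisor the second one is
  \<open>p c^(p - 1)\<close>, so that prime would be \<open>p\<close>, which does not divide \<open>a\<close>, or would divide both \<open>b\<close> and
  \<open>c\<close>. Coprime factors of a \<open>p\<close>-th power are \<open>p\<close>-th powers, with no sign ambiguity for odd \<open>p\<close>.
\<close>

lemma barlow_relations:
  fixes a b c :: int and p :: nat
  assumes p: "prime p" "odd p" and eq: "a ^ p + b ^ p + c ^ p = 0"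
    and bc: "coprime b c" and pa: "\<not> int p dvd a"
  obtains r s where "b + c = r ^ p" "pow_sum_cofactor p b c = s ^ p" "a = - (r * s)"
proof -
  let ?R = "pow_sum_cofactor p b c"
  have prod: "(b + c) * ?R = (- a) ^ p"
    using eq pow_sum_factor[OF p(2), of b c] p by simp
  have "coprime (b + c) ?R"
  proof (rule ccontr)
    assume "\<not> coprime (b + c) ?R"
    hence "\<not> is_unit (gcd (b + c) ?R)"
      by (simp add: is_unit_gcd coprime_iff_gcd_eq_1)
    moreover have "gcd (b + c) ?R \<noteq> 0"
      using prod pa by auto
    ultimately obtain q where "prime q" "q dvd gcd (b + c) ?R"
      using prime_divisor_exists by blast
    hence q: "prime q" "q dvd b + c" "q dvd ?R"
      by auto
    have "[?R = int p * c ^ (p - 1)] (mod q)"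
      using p q by (intro pow_sum_cofactor_cong_neg) (auto simp: cong_0_iff)
    hence "q dvd int p * c ^ (p - 1)"
      using q cong_dvd_iff by blast
    hence "q dvd int p \<or> q dvd c"
      using q prime_dvd_mult_iff prime_dvd_power by blast
    moreover have "\<not> q dvd c"
      using q bc by (metis coprime_common_divisor dvd_add_left_iff not_prime_unit)
    moreover have "\<not> q dvd int p"
    proof
      assume "q dvd int p"
      hence "q = int p"
        using q p by (simp add: primes_dvd_imp_eq)
      moreover have "q dvd (- a) ^ p"
        using q prod by (metis dvd_mult2)
      ultimately show False
        using q pa prime_dvd_power by (metis dvd_minus_iff)
    qed
    ultimately show False by blast
  qed
  moreover from this have "coprime ?R (b + c)"
    by (simp add: coprime_commute)
  ultimately obtain r s where rs: "b + c = r ^ p" "?R = s ^ p"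
    using coprime_mult_eq_power_int[OF p(2)] prod by (metis mult.commute)
  have "(r * s) ^ p = (- a) ^ p"
    using prod by (simp add: rs power_mult_distrib)
  \<comment> \<open>Odd powers are injective on the reals, whatever the signs.\<close>
  hence "real_of_int (r * s) ^ p = real_of_int (- a) ^ p"
    by (simp only: of_int_power[symmetric])
  hence "real_of_int (r * s) = real_of_int (- a)"
    using odd_real_root_power_cancel[OF p(2)] by metis
  hence "r * s = - a"
    by (simp only: of_int_eq_iff)
  thus thesis using that rs by simp
qed

text \<open>
  Write \<open>b + c = r\<^sup>p\<close>, \<open>c + a = s\<^sup>p\<close>, \<open>a + b = t\<^sup>p\<close>, and let \<open>r'\<^sup>p\<close>, \<open>t'\<^sup>p\<close> be the cofactors for \<open>(b, c)\<close> and
  \<open>(a, b)\<close>. If \<open>l\<close> divides \<open>a\<close>, then \<open>s\<^sup>p + t\<^sup>p - r\<^sup>p = 2 a\<close> vanishes modulo \<open>l\<close>, so \<open>l\<close> divides one of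
  \<open>r\<close>, \<open>s\<close>, \<open>t\<close>. It must be \<open>r\<close>, because \<open>s\<close> and \<open>t\<close> divide \<open>b\<close> and \<open>c\<close>. Now \<open>b = -c\<close> and \<open>a = 0\<close>
  modulo \<open>l\<close>, hence \<open>r'\<^sup>p = p c^(p - 1)\<close> and \<open>t'\<^sup>p = c^(p - 1)\<close>, and \<open>p = (r' / t')\<^sup>p\<close>.
\<close>

lemma germain_no_divisible_solution:
  fixes a b c :: int and l n p :: nat
  assumes p: "prime p" "odd p" and l: "prime l" "l = 1 + n * p" and n: "n > 0" "even n"
    and theta: "\<not> int l dvd theta n"
    and no_root: "\<not> (\<exists>x::int. [x ^ p = int p] (mod int l))"
    and eq: "a ^ p + b ^ p + c ^ p = 0" and abc: "\<not> int p dvd a * b * c"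
    and coprime: "coprime a b" "coprime b c" "coprime c a"
  shows "\<not> int l dvd a"
proof
  assume la: "int l dvd a"
  have l_prime: "prime (int l)"
    using l(1) by simp
  have lb: "\<not> int l dvd b" and lc: "\<not> int l dvd c"
    using la coprime l_prime by (metis coprime_common_divisor not_prime_unit)+
  have p_ndvd: "\<not> int p dvd a" "\<not> int p dvd b" "\<not> int p dvd c"
    using abc by (auto simp: dvd_mult dvd_mult2)
  have eqs: "b ^ p + c ^ p + a ^ p = 0" "c ^ p + a ^ p + b ^ p = 0"
    using eq by auto
  obtain r r' where r: "b + c = r ^ p" "pow_sum_cofactor p b c = r' ^ p" "a = - (r * r')"
    by (rule barlow_relations[OF p eq coprime(2) p_ndvd(1)])
  obtain s s' where s: "c + a = s ^ p" "pow_sum_cofactor p c a = s' ^ p" "b = - (s * s')"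
    by (rule barlow_relations[OF p eqs(1) coprime(3) p_ndvd(2)])
  obtain t t' where t: "a + b = t ^ p" "pow_sum_cofactor p a b = t' ^ p" "c = - (t * t')"
    by (rule barlow_relations[OF p eqs(2) coprime(1) p_ndvd(3)])
  have "s ^ p + t ^ p + (- r) ^ p = 2 * a"
    using p by (simp flip: r(1) s(1) t(1))
  hence "[s ^ p + t ^ p + (- r) ^ p = 0] (mod int l)"
    using la by (simp add: cong_0_iff)
  hence "int l dvd s \<or> int l dvd t \<or> int l dvd - r"
    using p l n theta prime_gt_1_nat by (intro fermat_equation_mod_prime[of l n p]) auto
  moreover have "\<not> int l dvd s" "\<not> int l dvd t" and lt': "\<not> int l dvd t'"
    using lb lc by (auto simp: s(3) t(3))
  ultimately have "int l dvd r"
    by simp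
  hence "[b + c = 0] (mod int l)"
    using p by (simp add: r(1) cong_0_iff dvd_power_le prime_gt_0_nat dvd_trans[OF _ dvd_power])
  hence bc: "[b = - c] (mod int l)"
    by (simp add: cong_iff_dvd_diff)
  have r': "[r' ^ p = int p * c ^ (p - 1)] (mod int l)"
    using pow_sum_cofactor_cong_neg[OF p(2) \<open>[b + c = 0] (mod int l)\<close>] by (simp add: r)
  have "[t' ^ p = b ^ (p - 1)] (mod int l)"
    using pow_sum_cofactor_cong_0[OF p(2), of a "int l" b] la by (simp add: t cong_0_iff)
  also have "[b ^ (p - 1) = (- c) ^ (p - 1)] (mod int l)"
    using bc by (rule cong_pow)
  also have "(- c) ^ (p - 1) = c ^ (p - 1)"
    using p by simp
  finally have t': "[t' ^ p = c ^ (p - 1)] (mod int l)" .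
  obtain z where z: "[t' * z = 1] (mod int l)"
    using inverse_mod_prime[OF l(1) lt'] by blast
  have "[r' ^ p * z ^ p = int p * c ^ (p - 1) * z ^ p] (mod int l)"
    using r' by (rule cong_mult) simp
  also have "[int p * c ^ (p - 1) * z ^ p = int p * t' ^ p * z ^ p] (mod int l)"
    using t' by (intro cong_mult cong_refl) (rule cong_sym)
  also have "int p * t' ^ p * z ^ p = int p * (t' * z) ^ p"
    by (simp add: power_mult_distrib)
  also have "[int p * (t' * z) ^ p = int p * 1 ^ p] (mod int l)"
    using z by (intro cong_mult cong_refl cong_pow)
  finally have "[(r' * z) ^ p = int p] (mod int l)"
    by (simp add: power_mult_distrib)
  thus False using no_root by blast
qed

text \<open>
  Divide by the greatest common divisor of all three numbers. A common divisor of two of the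
  quotients then divides the third one by the equation itself.
\<close>

lemma primitive_fermat_solution:
  fixes a b c :: int
  assumes p: "p > 0" and nz: "a \<noteq> 0" and eq: "a ^ p + b ^ p + c ^ p = 0"
  obtains a' b' c' where "a' ^ p + b' ^ p + c' ^ p = 0"
    "a' dvd a" "b' dvd b" "c' dvd c" "coprime a' b'" "coprime b' c'" "coprime c' a'"
proof -
  define d where "d = gcd a (gcd b c)"
  have "d \<noteq> 0" using nz by (simp add: d_def)
  have dvd: "d dvd a" "d dvd b" "d dvd c"
    by (auto simp: d_def intro: dvd_trans)
  obtain a' where a': "a = d * a'"
    using dvd(1) by (rule dvdE)
  obtain b' where b': "b = d * b'"
    using dvd(2) by (rule dvdE)
  obtain c' where c': "c = d * c'"
    using dvd(3) by (rule dvdE)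
  note abc = a' b' c'
  have "d ^ p * (a' ^ p + b' ^ p + c' ^ p) = 0"
    using eq by (simp add: abc power_mult_distrib algebra_simps)
  hence eq': "a' ^ p + b' ^ p + c' ^ p = 0"
    using \<open>d \<noteq> 0\<close> by simp
  have unit: "is_unit q" if "q dvd a'" "q dvd b'" "q dvd c'" for q
  proof -
    have "d * q dvd d"
      using that unfolding d_def[symmetric] by (subst (2) d_def) (simp add: abc)
    thus ?thesis using \<open>d \<noteq> 0\<close> by simp
  qed
  have coprime: "coprime x y"
    if sol: "x ^ p + y ^ p + z ^ p = 0" and unit: "\<And>q. q dvd x \<Longrightarrow> q dvd y \<Longrightarrow> q dvd z \<Longrightarrow> is_unit q"
    for x y z :: int
  proof (rule coprimeI)
    fix q assume q: "q dvd x" "q dvd y"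
    have "z ^ p = - (x ^ p + y ^ p)"
      using sol by linarith
    moreover have "q ^ p dvd x ^ p + y ^ p"
      using q by (intro dvd_add dvd_power_same)
    ultimately have "q ^ p dvd z ^ p"
      by (simp only: dvd_minus_iff)
    hence "q dvd z"
      using p by simp
    thus "is_unit q" using unit q by blast
  qed
  show thesis
    by (rule that[OF eq' _ _ _ coprime[OF eq'] coprime[of b' c' a'] coprime[of c' a' b']])
      (use eq' unit in \<open>auto simp: abc\<close>)
qed

section \<open>First case of Fermat's last theorem\<close>

theorem theorem3p21:
  fixes p l n :: nat
  assumes "prime p" and "p > 2"
    and "n \<ge> 2" and "l = 1 + n * p" and "prime l"
    and "\<not> int l dvd theta n"
    and "\<not> (\<exists>x::int. [x ^ p = int p] (mod int l))"
  shows "\<not> (\<exists>a b c::int. \<not> int p dvd a * b * c \<and> a ^ p + b ^ p + c ^ p = 0)"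
proof
  assume "\<exists>a b c::int. \<not> int p dvd a * b * c \<and> a ^ p + b ^ p + c ^ p = 0"
  then obtain a0 b0 c0 :: int
    where sol0: "\<not> int p dvd a0 * b0 * c0" "a0 ^ p + b0 ^ p + c0 ^ p = 0"
    by blast
  have "odd p"
    using assms(1,2) prime_odd_nat by blast
  have "l > 2"
    using assms(2,3,4) by (cases n) auto
  hence "odd l"
    using assms(5) prime_odd_nat by blast
  hence "even n"
    using \<open>odd p\<close> assms(4) by simp
  have "a0 \<noteq> 0" using sol0 by auto
  obtain a b c where sol: "a ^ p + b ^ p + c ^ p = 0"
    and dvd: "a dvd a0" "b dvd b0" "c dvd c0"
    and coprime: "coprime a b" "coprime b c" "coprime c a"
    using primitive_fermat_solution[OF _ \<open>a0 \<noteq> 0\<close> sol0(2)] assms(2) by auto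
  have "a * b * c dvd a0 * b0 * c0"
    using dvd by (intro mult_dvd_mono)
  hence abc: "\<not> int p dvd a * b * c"
    using sol0(1) dvd_trans by blast
  have "int l dvd a \<or> int l dvd b \<or> int l dvd c"
    using assms \<open>even n\<close> sol by (intro fermat_equation_mod_prime[of l n p]) auto
  moreover have "\<not> int l dvd x"
    if "x ^ p + y ^ p + z ^ p = 0" "\<not> int p dvd x * y * z"
      "coprime x y" "coprime y z" "coprime z x" for x y z
    using assms \<open>odd p\<close> \<open>even n\<close> that
    by (intro germain_no_divisible_solution[of p l n x y z]) auto
  from this[of a b c] this[of b c a] this[of c a b]
  have "\<not> int l dvd a" "\<not> int l dvd b" "\<not> int l dvd c"
    using sol abc coprime by (simp_all add: ac_simps)
  ultimately show False by blast
qed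

end
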